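(* Let $\mathcal{K}(\mathbb{M}_2)\cong\mathbb{R}^6$ be the space of Killing $2$-tensors of the Minkowski plane with coordinates $(A,B,C,\alpha,\beta,\gamma)$, and let $G_M$, $R_0$, $R_1$, $S_1$, $S_2$, $S_3$ and $\Theta_1,\dots,\Theta_8$ be as defined in the context. All the sets $\Theta_1,\dots,\Theta_8$ are connected, and hence the set $S_2\setminus(S_1\cup S_3)$ has $8$ connected components. This set consists of exactly two orbits of the action of $G_M$: $\Theta_1\cup\Theta_3\cup\Theta_5\cup\Theta_7$ and $\Theta_2\cup\Theta_4\cup\Theta_6\cup\Theta_8$ (in both cases the components are linked by the transformations $R_0$ and $R_1$).
   Context: In the Minkowski plane $\mathbb{M}_2$ with pseudo-Cartesian coordinates $(t,x)$ and metric $\mathbf{g}$ with contravariant components $\mathrm{diag}(1,-1)$, the general Killing $2$-tensor has contravariant components $K^{11}=A+2\alpha x+\gamma x^2$, $K^{12}=K^{21}=C+\alpha t+\beta x+\gamma tx$, $K^{22}=B+2\beta t+\gamma t^2$, with $A,B,C,\alpha,\beta,\gamma\in\mathbb{R}$. So the vector space $\mathcal{K}(\mathbb{M}_2)$ of Killing $2$-tensors is identified with $\mathbb{R}^6$ with coordinates $(A,B,C,\alpha,\beta,\gamma)$. With respect to $(\partial_A,\partial_B,\partial_C,\partial_\alpha,\partial_\beta,\partial_\gamma)$ define the vector fields on $\mathcal{K}(\mathbb{M}_2)$: $V_1=(0,-2\beta,-\alpha,0,-\gamma,0)$ and $V_2=(-2\alpha,0,-\beta,-\gamma,0,0)$ (translations);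 $V_3=(2C,2C,A+B,\beta,\alpha,0)$ (boost); $V_4=(2A,2B,2C,\alpha,\beta,0)$ (dilatation of the plane); $V_5=(1,-1,0,0,0,0)$ (addition of a multiple of the metric); $V_6=(A,B,C,\alpha,\beta,\gamma)$ (scalar multiplication). Discrete transformations of $\mathcal{K}(\mathbb{M}_2)$ (unlisted coordinates are unchanged): $R_0:\mathbf{K}\mapsto-\mathbf{K}$; $R_1: C\mapsto-C,\ \alpha\mapsto-\alpha$; $R_2: C\mapsto-C,\ \beta\mapsto-\beta$. $G_M$ is the group of transformations of $\mathcal{K}(\mathbb{M}_2)$ generated by the flows of $V_1,\dots,V_6$ and by $R_0,R_1,R_2$. Two sets are "linked" by a set of discrete transformations if one is mapped onto the other by some composition of them. Put $Z_+=\gamma(A+B-2C)-(\alpha-\beta)^2$ and $Z_-=\gamma(A+B+2C)-(\alpha+\beta)^2$. $S_1=\{\gamma=0\}$; $S_2=\{Z_+Z_-=0\}$; $S_3=\{\gamma(A+B)=\alpha^2+\beta^2,\ \gamma C=\alpha\beta\}$. The sets $\Theta_1,\dots,\Theta_8$ partition $S_2\setminus(S_1\cup S_3)$ according to the signs ($+$, $-$ or $0$) of $(\gamma,Z_+,Z_-)$: $\Theta_1:(+,0,+)$, $\Theta_2:(+,0,-)$, $\Theta_3:(+,+,0)$, $\Theta_4:(+,-,0)$, $\Theta_5:(-,0,+)$, $\Theta_6:(-,0,-)$, $\Theta_7:(-,+,0)$, $\Theta_8:(-,-,0)$. *)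

theory Defs
  imports "HOL-Analysis.Analysis" "HOL-Algebra.Group_Action" "HOL-Algebra.Generated_Groups"
begin

text \<open>
  A point \<open>(A, B, C, \<alpha>, \<beta>, \<gamma>)\<close> stands for the Killing 2-tensor of the Minkowski
  plane whose contravariant components in pseudo-Cartesian coordinates \<open>(t, x)\<close> are
  \<open>K11 = A + 2 \<alpha> x + \<gamma> x^2\<close>, \<open>K12 = K21 = C + \<alpha> t + \<beta> x + \<gamma> t x\<close> and
  \<open>K22 = B + 2 \<beta> t + \<gamma> t^2\<close>.  The product type carries the Euclidean topology of
  the six-dimensional real space.
\<close>

type_synonym killing = "real \<times> real \<times> real \<times> real \<times> real \<times> real"

fun V1 :: "killing \<Rightarrow> killing" where
  "V1 (A, B, C, \<alpha>, \<beta>, \<gamma>) = (0, - 2 * \<beta>, - \<alpha>, 0, - \<gamma>, 0)"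

fun V2 :: "killing \<Rightarrow> killing" where
  "V2 (A, B, C, \<alpha>, \<beta>, \<gamma>) = (- 2 * \<alpha>, 0, - \<beta>, - \<gamma>, 0, 0)"

fun V3 :: "killing \<Rightarrow> killing" where
  "V3 (A, B, C, \<alpha>, \<beta>, \<gamma>) = (2 * C, 2 * C, A + B, \<beta>, \<alpha>, 0)"

fun V4 :: "killing \<Rightarrow> killing" where
  "V4 (A, B, C, \<alpha>, \<beta>, \<gamma>) = (2 * A, 2 * B, 2 * C, \<alpha>, \<beta>, 0)"

fun V5 :: "killing \<Rightarrow> killing" where
  "V5 (A, B, C, \<alpha>, \<beta>, \<gamma>) = (1, - 1, 0, 0, 0, 0)"

fun V6 :: "killing \<Rightarrow> killing" where
  "V6 (A, B, C, \<alpha>, \<beta>, \<gamma>) = (A, B, C, \<alpha>, \<beta>, \<gamma>)"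

fun R0 :: "killing \<Rightarrow> killing" where
  "R0 (A, B, C, \<alpha>, \<beta>, \<gamma>) = (- A, - B, - C, - \<alpha>, - \<beta>, - \<gamma>)"

fun R1 :: "killing \<Rightarrow> killing" where
  "R1 (A, B, C, \<alpha>, \<beta>, \<gamma>) = (A, B, - C, - \<alpha>, \<beta>, \<gamma>)"

fun R2 :: "killing \<Rightarrow> killing" where
  "R2 (A, B, C, \<alpha>, \<beta>, \<gamma>) = (A, B, - C, \<alpha>, - \<beta>, \<gamma>)"

text \<open>
  Global flows suffice: \<open>V1\<close>, ..., \<open>V6\<close> are affine, hence complete, and each has
  exactly one flow.
\<close>

definition is_flow :: "('a::real_normed_vector \<Rightarrow> 'a) \<Rightarrow> (real \<Rightarrow> 'a \<Rightarrow> 'a) \<Rightarrow> bool" where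
  "is_flow V \<phi> \<longleftrightarrow>
     (\<forall>x. \<phi> 0 x = x) \<and>
     (\<forall>s t x. \<phi> (s + t) x = \<phi> s (\<phi> t x)) \<and>
     (\<forall>t x. ((\<lambda>s. \<phi> s x) has_vector_derivative V (\<phi> t x)) (at t))"

definition GM_generators :: "(killing \<Rightarrow> killing) set" where
  "GM_generators =
     {\<phi> t | V \<phi> t. V \<in> {V1, V2, V3, V4, V5, V6} \<and> is_flow V \<phi>} \<union> {R0, R1, R2}"

definition GM :: "(killing \<Rightarrow> killing) monoid" where
  "GM = (BijGroup UNIV)\<lparr>carrier := generate (BijGroup UNIV) GM_generators\<rparr>"

lemma GM_generators_subset: "GM_generators \<subseteq> carrier (BijGroup UNIV)"
proof -
  have "bij (\<phi> t)" if f: "is_flow V \<phi>" for V :: "killing \<Rightarrow> killing" and \<phi> t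
  proof (rule o_bij[where g = "\<phi> (- t)"])
    have add: "\<phi> s (\<phi> r x) = \<phi> (s + r) x" and zero: "\<phi> 0 x = x" for s r x
      using f unfolding is_flow_def by metis+
    show "\<phi> (- t) \<circ> \<phi> t = id" by (simp add: fun_eq_iff add zero)
    show "\<phi> t \<circ> \<phi> (- t) = id" by (simp add: fun_eq_iff add zero)
  qed
  moreover have "bij R0" by (rule o_bij[where g = R0]) (auto simp: fun_eq_iff)
  moreover have "bij R1" by (rule o_bij[where g = R1]) (auto simp: fun_eq_iff)
  moreover have "bij R2" by (rule o_bij[where g = R2]) (auto simp: fun_eq_iff)
  ultimately show ?thesis
    by (auto simp: GM_generators_def BijGroup_def Bij_def)
qed

lemma GM_group_action: "group_action GM UNIV (\<lambda>g. g)"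
proof -
  interpret B: group "BijGroup (UNIV :: killing set)" by (rule group_BijGroup)
  have sub: "subgroup (generate (BijGroup UNIV) GM_generators) (BijGroup UNIV)"
    by (rule B.generate_is_subgroup[OF GM_generators_subset])
  have "group GM" unfolding GM_def by (rule B.subgroup_imp_group[OF sub])
  moreover have "(\<lambda>g. g) \<in> hom GM (BijGroup UNIV)"
    using subgroup.subset[OF sub] by (auto simp: hom_def GM_def)
  ultimately show ?thesis
    by (simp add: group_action_def group_hom_def group_hom_axioms_def group_BijGroup)
qed

fun gam :: "killing \<Rightarrow> real" where
  "gam (A, B, C, \<alpha>, \<beta>, \<gamma>) = \<gamma>"

fun Zplus :: "killing \<Rightarrow> real" where
  "Zplus (A, B, C, \<alpha>, \<beta>, \<gamma>) = \<gamma> * (A + B - 2 * C) - (\<alpha> - \<beta>)\<^sup>2"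

fun Zminus :: "killing \<Rightarrow> real" where
  "Zminus (A, B, C, \<alpha>, \<beta>, \<gamma>) = \<gamma> * (A + B + 2 * C) - (\<alpha> + \<beta>)\<^sup>2"

definition S1 :: "killing set" where
  "S1 = {K. gam K = 0}"

definition S2 :: "killing set" where
  "S2 = {K. Zplus K * Zminus K = 0}"

definition S3 :: "killing set" where
  "S3 = {(A, B, C, \<alpha>, \<beta>, \<gamma>) | A B C \<alpha> \<beta> \<gamma>.
           \<gamma> * (A + B) = \<alpha>\<^sup>2 + \<beta>\<^sup>2 \<and> \<gamma> * C = \<alpha> * \<beta>}"

definition sign_class :: "real \<Rightarrow> real \<Rightarrow> real \<Rightarrow> killing set" where
  "sign_class a b c =
     {K \<in> S2 - (S1 \<union> S3). sgn (gam K) = a \<and> sgn (Zplus K) = b \<and> sgn (Zminus K) = c}"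

definition "\<Theta>1 = sign_class 1 0 1"
definition "\<Theta>2 = sign_class 1 0 (- 1)"
definition "\<Theta>3 = sign_class 1 1 0"
definition "\<Theta>4 = sign_class 1 (- 1) 0"
definition "\<Theta>5 = sign_class (- 1) 0 1"
definition "\<Theta>6 = sign_class (- 1) 0 (- 1)"
definition "\<Theta>7 = sign_class (- 1) 1 0"
definition "\<Theta>8 = sign_class (- 1) (- 1) 0"

definition linked_by :: "('a \<Rightarrow> 'a) set \<Rightarrow> 'a set \<Rightarrow> 'a set \<Rightarrow> bool" where
  "linked_by D X Y \<longleftrightarrow> (\<exists>fs \<in> lists D. foldr (\<circ>) fs id ` X = Y)"

end

theory Submission
  imports Defs
begin

text \<open>
  Since \<open>Zplus + Zminus = 2 (\<gamma> (A + B) - \<alpha>\<^sup>2 - \<beta>\<^sup>2)\<close> and \<open>Zminus - Zplus = 4 (\<gamma> C - \<alpha> \<beta>)\<close>, for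
  \<open>\<gamma> \<noteq> 0\<close> the set \<open>S3\<close> is the locus where both \<open>Zplus\<close> and \<open>Zminus\<close> vanish.  So the set under
  study consists of the tensors with \<open>\<gamma> \<noteq> 0\<close> for which exactly one of \<open>Zplus\<close>, \<open>Zminus\<close> vanishes,
  and its eight sign classes are the sets \<open>\<Theta>1\<close>, ..., \<open>\<Theta>8\<close>.

  Connectedness: where \<open>\<gamma> \<noteq> 0\<close>, the six functions \<open>\<gamma>\<close>, \<open>Zplus\<close>, \<open>Zminus\<close>, \<open>\<alpha>\<close>, \<open>\<beta>\<close>,
  \<open>(A - B) / 2\<close> are global coordinates, with the continuous inverse \<open>killing_of\<close>.  In these
  coordinates a sign class is a product of half-lines, points and lines, hence convex
  (\<open>connected_sign_class\<close>).  Conversely, \<open>\<gamma>\<close>, \<open>Zplus + Zminus\<close> and \<open>Zplus - Zminus\<close> are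
  continuous and have no zero on the set, so their signs are constant on connected subsets.
  These three signs determine the sign class, so the classes are the components
  (\<open>components_region\<close>).

  Orbits: each of the six fields multiplies each of \<open>\<gamma>\<close>, \<open>Zplus\<close>, \<open>Zminus\<close> by a constant when it acts
  as a derivation, so along the flows these functions are multiplied by positive numbers
  (\<open>flow_invariants\<close>).  Of the three functions, \<open>R0\<close> changes only the sign of \<open>\<gamma>\<close>, while
  \<open>R1\<close> and \<open>R2\<close> swap \<open>Zplus\<close> and \<open>Zminus\<close>.  Hence the sign \<open>e\<close> of the nonzero one of \<open>Zplus\<close> and \<open>Zminus\<close> is
  invariant under the group (\<open>region_of_sign_GM\<close>).  It is the only invariant: after \<open>R0\<close> and \<open>R1\<close>
  have arranged \<open>\<gamma> > 0\<close> and \<open>Zplus = 0\<close>, the translations remove \<open>\<alpha>\<close> and \<open>\<beta>\<close>, a multiple of the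
  metric makes \<open>A = B\<close>, so that \<open>Zplus = 0\<close> forces \<open>C = A\<close>, and the two scalings bring the tensor to
  \<open>(e, e, e, 0, 0, 1)\<close> (\<open>normal_form\<close>).
\<close>

section \<open>The sign classes\<close>

text \<open>
  The two equations of \<open>S3\<close> are, up to constant factors, the vanishing of
  \<open>Zplus + Zminus\<close> and of \<open>Zminus - Zplus\<close>.
\<close>

lemma S3_iff: "gam K \<noteq> 0 \<Longrightarrow> K \<in> S3 \<longleftrightarrow> Zplus K = 0 \<and> Zminus K = 0"
proof (cases K)
  case (fields A B C \<alpha> \<beta> \<gamma>)
  have "Zplus K + Zminus K = 2 * (\<gamma> * (A + B) - (\<alpha>\<^sup>2 + \<beta>\<^sup>2))"
    and "Zminus K - Zplus K = 4 * (\<gamma> * C - \<alpha> * \<beta>)"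
    by (simp_all add: fields algebra_simps power2_eq_square)
  moreover have "K \<in> S3 \<longleftrightarrow> \<gamma> * (A + B) = \<alpha>\<^sup>2 + \<beta>\<^sup>2 \<and> \<gamma> * C = \<alpha> * \<beta>"
    by (simp add: S3_def fields)
  ultimately show ?thesis by auto
qed

text \<open>
  Given \<open>Zplus * Zminus = 0\<close>, the sum \<open>Zplus + Zminus\<close> is the value of the factor that may be
  nonzero; so its vanishing says that both factors vanish.
\<close>

lemma region_eq:
  "S2 - (S1 \<union> S3) = {K. gam K \<noteq> 0 \<and> Zplus K * Zminus K = 0 \<and> Zplus K + Zminus K \<noteq> 0}"
  using S3_iff by (auto simp: S1_def S2_def)

definition sign_patterns :: "(real \<times> real \<times> real) set" where
  "sign_patterns =
     {(1, 0, 1), (1, 0, -1), (1, 1, 0), (1, -1, 0), (-1, 0, 1), (-1, 0, -1), (-1, 1, 0), (-1, -1, 0)}"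

lemma card_sign_patterns: "card sign_patterns = 8"
  by (simp add: sign_patterns_def)

lemma sign_patterns_range:
  assumes "(a, b, c) \<in> sign_patterns"
  shows "a = 1 \<or> a = - 1" "b * c = 0" "b + c \<noteq> 0" "b = 0 \<or> b = 1 \<or> b = - 1" "c = 0 \<or> c = 1 \<or> c = - 1"
  using assms by (auto simp: sign_patterns_def)

text \<open>
  For the eight patterns, the sign conditions alone already place the point outside \<open>S1\<close> and \<open>S3\<close>.
\<close>

lemma sign_class_eq:
  assumes "(a, b, c) \<in> sign_patterns"
  shows "sign_class a b c = {K. sgn (gam K) = a \<and> sgn (Zplus K) = b \<and> sgn (Zminus K) = c}"
proof (rule Set.set_eqI)
  fix K
  have "K \<in> S2 - (S1 \<union> S3)" if "sgn (gam K) = a" "sgn (Zplus K) = b" "sgn (Zminus K) = c"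
    using that sign_patterns_range(1-3)[OF assms] unfolding region_eq
    by (auto simp: sgn_if split: if_splits)
  then show "K \<in> sign_class a b c \<longleftrightarrow>
      K \<in> {K. sgn (gam K) = a \<and> sgn (Zplus K) = b \<and> sgn (Zminus K) = c}"
    unfolding sign_class_def by blast
qed

lemma Theta_family:
  "{\<Theta>1, \<Theta>2, \<Theta>3, \<Theta>4, \<Theta>5, \<Theta>6, \<Theta>7, \<Theta>8} = (\<lambda>(a, b, c). sign_class a b c) ` sign_patterns"
  unfolding sign_patterns_def \<Theta>1_def \<Theta>2_def \<Theta>3_def \<Theta>4_def \<Theta>5_def \<Theta>6_def \<Theta>7_def \<Theta>8_def
  by simp

lemma region_sign_pattern:
  assumes "K \<in> S2 - (S1 \<union> S3)"
  shows "(sgn (gam K), sgn (Zplus K), sgn (Zminus K)) \<in> sign_patterns"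
  using assms unfolding region_eq sign_patterns_def by (auto simp: sgn_if)

lemma region_eq_Union_sign_classes:
  "S2 - (S1 \<union> S3) = (\<Union>(a, b, c)\<in>sign_patterns. sign_class a b c)"
  using region_sign_pattern by (fastforce simp: sign_class_def)

section \<open>Connectedness of the sign classes\<close>

text \<open>
  The inverse of the coordinate change to \<open>\<gamma>, Zplus, Zminus, \<alpha>, \<beta>, (A - B) / 2\<close>: here \<open>u\<close> is
  \<open>A + B - 2 * C\<close> and \<open>v\<close> is \<open>A + B + 2 * C\<close>.
\<close>

fun killing_of :: "real \<times> real \<times> real \<times> real \<times> real \<times> real \<Rightarrow> killing" where
  "killing_of (\<gamma>, p, q, \<alpha>, \<beta>, w) =
     (let u = (p + (\<alpha> - \<beta>)\<^sup>2) / \<gamma>; v = (q + (\<alpha> + \<beta>)\<^sup>2) / \<gamma>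
      in ((u + v) / 4 + w, (u + v) / 4 - w, (v - u) / 4, \<alpha>, \<beta>, \<gamma>))"

lemma killing_of_values:
  assumes "\<gamma> \<noteq> 0"
  shows "gam (killing_of (\<gamma>, p, q, \<alpha>, \<beta>, w)) = \<gamma>"
    and "Zplus (killing_of (\<gamma>, p, q, \<alpha>, \<beta>, w)) = p"
    and "Zminus (killing_of (\<gamma>, p, q, \<alpha>, \<beta>, w)) = q"
  using assms by (simp_all add: Let_def field_simps)

lemma killing_of_surj:
  assumes "gam K \<noteq> 0"
  shows "\<exists>\<alpha> \<beta> w. K = killing_of (gam K, Zplus K, Zminus K, \<alpha>, \<beta>, w)"
proof (cases K)
  case (fields A B C \<alpha> \<beta> \<gamma>)
  with assms have "K = killing_of (gam K, Zplus K, Zminus K, \<alpha>, \<beta>, (A - B) / 2)"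
    by (simp add: Let_def field_simps)
  then show ?thesis by blast
qed

text \<open>
  The form with projections, to which the continuity rules apply.
\<close>

lemma killing_of_eq:
  "killing_of = (\<lambda>x. let \<gamma> = fst x; p = fst (snd x); q = fst (snd (snd x));
      \<alpha> = fst (snd (snd (snd x))); \<beta> = fst (snd (snd (snd (snd x))));
      w = snd (snd (snd (snd (snd x))));
      u = (p + (\<alpha> - \<beta>)\<^sup>2) / \<gamma>; v = (q + (\<alpha> + \<beta>)\<^sup>2) / \<gamma>
      in ((u + v) / 4 + w, (u + v) / 4 - w, (v - u) / 4, \<alpha>, \<beta>, \<gamma>))"
  by (auto simp: fun_eq_iff Let_def)

lemma sign_class_eq_image:
  assumes "(a, b, c) \<in> sign_patterns"
  shows "sign_class a b c =
    killing_of ` ({x. sgn x = a} \<times> {x. sgn x = b} \<times> {x. sgn x = c} \<times> UNIV)"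
proof -
  have "gam K \<noteq> 0" if "sgn (gam K) = a" for K
    using that sign_patterns_range(1)[OF assms] by auto
  moreover have "\<gamma> \<noteq> 0" if "sgn \<gamma> = a" for \<gamma> :: real
    using that sign_patterns_range(1)[OF assms] by auto
  ultimately show ?thesis
    unfolding sign_class_eq[OF assms] using killing_of_surj
    by (auto simp: killing_of_values image_iff simp del: killing_of.simps) metis
qed

lemma convex_sgn_level:
  assumes "a = 0 \<or> a = 1 \<or> a = (- 1 :: real)"
  shows "convex {x. sgn x = a}"
proof -
  have "{x :: real. sgn x = 0} = {0}" "{x :: real. sgn x = 1} = {0<..}"
    "{x :: real. sgn x = - 1} = {..<0}"
    by (auto simp: sgn_if split: if_splits)
  with assms show ?thesis by auto
qed

text \<open>
  In the new coordinates a sign class is a product of convex sets of reals, and \<open>killing_of\<close> is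
  continuous there because \<open>\<gamma>\<close> is nonzero.
\<close>

lemma connected_sign_class:
  assumes "(a, b, c) \<in> sign_patterns"
  shows "connected (sign_class a b c)"
  unfolding sign_class_eq_image[OF assms]
proof (rule connected_continuous_image)
  show "continuous_on ({x. sgn x = a} \<times> {x. sgn x = b} \<times> {x. sgn x = c} \<times> UNIV) killing_of"
    unfolding killing_of_eq Let_def
    using sign_patterns_range(1)[OF assms] by (auto intro!: continuous_intros)
  show "connected ({x. sgn x = a} \<times> {x. sgn x = b} \<times> {x. sgn x = c} \<times> (UNIV :: (real \<times> real \<times> real) set))"
    using sign_patterns_range[OF assms]
    by (intro convex_connected convex_Times convex_sgn_level convex_UNIV) auto
qed

lemma sign_class_nonempty:
  assumes "(a, b, c) \<in> sign_patterns"
  shows "sign_class a b c \<noteq> {}"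
proof -
  have "a \<in> {x. sgn x = a}" "b \<in> {x. sgn x = b}" "c \<in> {x. sgn x = c}"
    using sign_patterns_range[OF assms] by auto
  then show ?thesis unfolding sign_class_eq_image[OF assms] by blast
qed

lemma inj_on_sign_class: "inj_on (\<lambda>(a, b, c). sign_class a b c) sign_patterns"
proof (clarsimp simp: inj_on_def)
  fix a b c a' b' c'
  assume "(a, b, c) \<in> sign_patterns" and eq: "sign_class a b c = sign_class a' b' c'"
  then obtain K where "K \<in> sign_class a b c" using sign_class_nonempty by blast
  with eq show "a = a' \<and> b = b' \<and> c = c'" by (auto simp: sign_class_def)
qed

section \<open>Connected components\<close>

text \<open>
  A criterion for components of a set that need not be open: a connected piece that absorbs every
  connected subset meeting it is a maximal connected subset.
\<close>

lemma components_eqI: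
  assumes "\<And>T. T \<in> F \<Longrightarrow> connected T" "\<And>T. T \<in> F \<Longrightarrow> T \<noteq> {}" "S = \<Union>F"
    and absorb: "\<And>T C. T \<in> F \<Longrightarrow> connected C \<Longrightarrow> C \<subseteq> S \<Longrightarrow> T \<inter> C \<noteq> {} \<Longrightarrow> C \<subseteq> T"
  shows "components S = F"
proof -
  have F: "T \<in> components S" if "T \<in> F" for T
    unfolding in_components_maximal
    using that assms by (metis Union_upper inf.absorb_iff1 subset_antisym)
  have "C \<in> F" if C: "C \<in> components S" for C
  proof -
    obtain x where "x \<in> C" "x \<in> S"
      using in_components_nonempty[OF C] in_components_subset[OF C] by blast
    then obtain T where "T \<in> F" "x \<in> T" using \<open>S = \<Union>F\<close> by blast
    with C F \<open>x \<in> C\<close> have "C = T" by (metis components_nonoverlap disjoint_iff)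
    with \<open>T \<in> F\<close> show ?thesis by simp
  qed
  with F show ?thesis by blast
qed

lemma sgn_const_on_connected:
  fixes f :: "'a :: topological_space \<Rightarrow> real"
  assumes "connected C" "continuous_on C f" "\<And>x. x \<in> C \<Longrightarrow> f x \<noteq> 0" "x \<in> C" "y \<in> C"
  shows "sgn (f x) = sgn (f y)"
proof -
  have con: "connected (f ` C)" using assms by (simp add: connected_continuous_image)
  have no: "\<not> (f u < 0 \<and> 0 < f v)" if "u \<in> C" "v \<in> C" for u v
    using connectedD_interval[OF con, of "f u" "f v" 0] that assms(3) by force
  show ?thesis
    using no[of x y] no[of y x] assms(3)[of x] assms(3)[of y] assms(4,5) by (auto simp: sgn_if)
qed

lemma Z_coordinates:
  "gam = (\<lambda>K. snd (snd (snd (snd (snd K)))))"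
  "Zplus = (\<lambda>K. snd (snd (snd (snd (snd K)))) * (fst K + fst (snd K) - 2 * fst (snd (snd K)))
     - (fst (snd (snd (snd K))) - fst (snd (snd (snd (snd K)))))\<^sup>2)"
  "Zminus = (\<lambda>K. snd (snd (snd (snd (snd K)))) * (fst K + fst (snd K) + 2 * fst (snd (snd K)))
     - (fst (snd (snd (snd K))) + fst (snd (snd (snd (snd K)))))\<^sup>2)"
  by (auto simp: fun_eq_iff)

lemma continuous_on_Z [continuous_intros]:
  "continuous_on S gam" "continuous_on S Zplus" "continuous_on S Zminus"
  unfolding Z_coordinates by (intro continuous_intros)+

text \<open>
  The functions \<open>Zplus\<close> and \<open>Zminus\<close> do vanish on the set, so the intermediate value argument
  applies not to them but to their sum and difference, whose absolute values agree and are nonzero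
  because exactly one of \<open>Zplus\<close>, \<open>Zminus\<close> is zero.  The two signs are equal if \<open>Zminus = 0\<close> and
  opposite if \<open>Zplus = 0\<close>.
\<close>

lemma connected_same_signs:
  assumes "connected C" "C \<subseteq> S2 - (S1 \<union> S3)" "K \<in> C" "L \<in> C"
  shows "sgn (gam K) = sgn (gam L)" "sgn (Zplus K) = sgn (Zplus L)" "sgn (Zminus K) = sgn (Zminus L)"
proof -
  have reg: "gam M \<noteq> 0" "Zplus M * Zminus M = 0" "Zplus M + Zminus M \<noteq> 0"
    "Zplus M - Zminus M \<noteq> 0" if "M \<in> C" for M
    using that assms(2) unfolding region_eq by auto
  note const = sgn_const_on_connected[OF assms(1) _ _ assms(3,4)]
  show "sgn (gam K) = sgn (gam L)"
    by (rule const) (auto intro!: continuous_intros reg)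
  have "sgn (Zplus K + Zminus K) = sgn (Zplus L + Zminus L)"
    "sgn (Zplus K - Zminus K) = sgn (Zplus L - Zminus L)"
    by (rule const; auto intro!: continuous_intros dest: reg)+
  then show "sgn (Zplus K) = sgn (Zplus L)" "sgn (Zminus K) = sgn (Zminus L)"
    using reg[OF assms(3)] reg[OF assms(4)] by (auto simp: sgn_if split: if_splits)
qed

lemma components_region:
  "components (S2 - (S1 \<union> S3)) = (\<lambda>(a, b, c). sign_class a b c) ` sign_patterns"
proof (rule components_eqI)
  show "S2 - (S1 \<union> S3) = \<Union> ((\<lambda>(a, b, c). sign_class a b c) ` sign_patterns)"
    by (rule region_eq_Union_sign_classes)
next
  fix T C
  assume "T \<in> (\<lambda>(a, b, c). sign_class a b c) ` sign_patterns"
    and C: "connected C" "C \<subseteq> S2 - (S1 \<union> S3)" and "T \<inter> C \<noteq> {}"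
  then obtain a b c where T: "T = sign_class a b c" by auto
  with \<open>T \<inter> C \<noteq> {}\<close> obtain K where K: "K \<in> sign_class a b c" "K \<in> C" by blast
  show "C \<subseteq> T"
  proof
    fix L assume "L \<in> C"
    from connected_same_signs[OF C \<open>K \<in> C\<close> this] K(1) C(2) \<open>L \<in> C\<close> show "L \<in> T"
      by (auto simp: T sign_class_def)
  qed
qed (auto simp: connected_sign_class sign_class_nonempty)

section \<open>The discrete transformations\<close>

lemma Z_R0: "gam (R0 K) = - gam K" "Zplus (R0 K) = Zplus K" "Zminus (R0 K) = Zminus K"
  by (cases K; simp add: algebra_simps power2_eq_square)+

lemma Z_R1: "gam (R1 K) = gam K" "Zplus (R1 K) = Zminus K" "Zminus (R1 K) = Zplus K"
  by (cases K; simp add: algebra_simps power2_eq_square)+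

lemma Z_R2: "gam (R2 K) = gam K" "Zplus (R2 K) = Zminus K" "Zminus (R2 K) = Zplus K"
  by (cases K; simp add: algebra_simps power2_eq_square)+

lemma R_involutions: "R0 (R0 K) = K" "R1 (R1 K) = K"
  by (cases K; simp)+

lemma R0_sign_class: "R0 ` sign_class a b c = sign_class (- a) b c"
proof -
  have sub: "R0 K \<in> sign_class (- a) b c" if "K \<in> sign_class a b c" for K a b c
    using that unfolding sign_class_def region_eq by (auto simp: Z_R0 sgn_minus)
  have "K \<in> R0 ` sign_class a b c" if "K \<in> sign_class (- a) b c" for K
    using sub[OF that] by (metis R_involutions(1) image_eqI minus_minus)
  with sub show ?thesis by blast
qed

lemma R1_sign_class: "R1 ` sign_class a b c = sign_class a c b"
proof -
  have sub: "R1 K \<in> sign_class a c b" if "K \<in> sign_class a b c" for K b c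
    using that unfolding sign_class_def region_eq by (auto simp: Z_R1 add.commute)
  have "K \<in> R1 ` sign_class a b c" if "K \<in> sign_class a c b" for K
    using sub[OF that] by (metis R_involutions(2) image_eqI)
  with sub show ?thesis by blast
qed

lemma linked_sign_classes:
  assumes "a' = a \<or> a' = - a" "(b', c') = (b, c) \<or> (b', c') = (c, b)"
  shows "linked_by {R0, R1} (sign_class a b c) (sign_class a' b' c')"
proof -
  have "\<exists>fs \<in> lists {R0}. foldr (\<circ>) fs id ` sign_class a b' c' = sign_class a' b' c'"
    using assms(1)
  proof
    assume "a' = a"
    then show ?thesis by (intro bexI[of _ "[]"]) auto
  next
    assume "a' = - a"
    then show ?thesis by (intro bexI[of _ "[R0]"]) (simp_all add: R0_sign_class)
  qed
  then obtain fs where fs: "fs \<in> lists {R0}"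
      "foldr (\<circ>) fs id ` sign_class a b' c' = sign_class a' b' c'" by (elim bexE)
  have "\<exists>gs \<in> lists {R1}. foldr (\<circ>) gs id ` sign_class a b c = sign_class a b' c'"
    using assms(2)
  proof
    assume "(b', c') = (b, c)"
    then show ?thesis by (intro bexI[of _ "[]"]) auto
  next
    assume "(b', c') = (c, b)"
    then show ?thesis by (intro bexI[of _ "[R1]"]) (simp_all add: R1_sign_class)
  qed
  then obtain gs where gs: "gs \<in> lists {R1}"
      "foldr (\<circ>) gs id ` sign_class a b c = sign_class a b' c'" by (elim bexE)
  have "foldr (\<circ>) (fs @ gs) id = foldr (\<circ>) fs id \<circ> foldr (\<circ>) gs id"
    by (induction fs) (simp_all add: o_assoc)
  then have "foldr (\<circ>) (fs @ gs) id ` sign_class a b c = sign_class a' b' c'"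
    by (simp only: image_comp[symmetric] fs(2) gs(2))
  moreover have "fs @ gs \<in> lists {R0, R1}"
    using fs(1) gs(1) by auto
  ultimately show ?thesis unfolding linked_by_def by (rule bexI)
qed

section \<open>The invariant of the group\<close>

text \<open>
  If \<open>F\<close> is an eigenfunction of the derivation \<open>V\<close>, then along a flow line it solves the linear
  equation \<open>f' = l f\<close>, so that \<open>exp (- l t) f\<close> is constant.  The argument covers every flow of \<open>V\<close>
  at once, whatever its formula.
\<close>

lemma flow_scales:
  assumes "is_flow V \<phi>" "\<And>K. (F has_derivative F' K) (at K)" "\<And>K. F' K (V K) = l * (F K :: real)"
  shows "F (\<phi> t K) = exp (l * t) * F K"
proof -
  have d: "((\<lambda>s. F (\<phi> s K)) has_real_derivative l * F (\<phi> s K)) (at s)" for s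
  proof -
    have "((\<lambda>s. \<phi> s K) has_vector_derivative V (\<phi> s K)) (at s)"
      using assms(1) by (simp add: is_flow_def)
    from vector_derivative_diff_chain_within[OF this, of F "F' (\<phi> s K)"] assms(2,3)
    show ?thesis
      by (simp add: has_real_derivative_iff_has_vector_derivative o_def has_derivative_at_withinI)
  qed
  have "((\<lambda>s. exp (- l * s) * F (\<phi> s K)) has_real_derivative 0) (at s)" for s
    by (rule derivative_eq_intros d refl | simp)+
  then have "exp (- l * t) * F (\<phi> t K) = exp (- l * 0) * F (\<phi> 0 K)"
    by (intro DERIV_isconst_all) auto
  moreover have "\<phi> 0 K = K" using assms(1) by (simp add: is_flow_def)
  ultimately show ?thesis by (simp add: exp_minus field_simps)
qed

text \<open>
  Differentials are written out in coordinates, so that evaluating them on a vector field is plain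
  algebra.
\<close>

lemma Z_derivatives:
  "(gam has_derivative (\<lambda>H. gam H)) (at K)"
  "(Zplus has_derivative (\<lambda>(a, b, c, d, e, g). case K of (A, B, C, \<alpha>, \<beta>, \<gamma>) \<Rightarrow>
      g * (A + B - 2 * C) + \<gamma> * (a + b - 2 * c) - 2 * (\<alpha> - \<beta>) * (d - e))) (at K)"
  "(Zminus has_derivative (\<lambda>(a, b, c, d, e, g). case K of (A, B, C, \<alpha>, \<beta>, \<gamma>) \<Rightarrow>
      g * (A + B + 2 * C) + \<gamma> * (a + b + 2 * c) - 2 * (\<alpha> + \<beta>) * (d + e))) (at K)"
  unfolding Z_coordinates
  by (auto intro!: derivative_eq_intros simp: case_prod_beta fun_eq_iff algebra_simps)

lemma flow_invariants:
  assumes "V \<in> {V1, V2, V3, V4, V5, V6}" "is_flow V \<phi>"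
  shows "\<exists>a>0. gam (\<phi> t K) = a * gam K" "\<exists>b>0. Zplus (\<phi> t K) = b * Zplus K"
    "\<exists>c>0. Zminus (\<phi> t K) = c * Zminus K"
proof -
  note sc = flow_scales[OF assms(2) Z_derivatives(1)] flow_scales[OF assms(2) Z_derivatives(2)]
    flow_scales[OF assms(2) Z_derivatives(3)]
  obtain l m n where
    "\<And>K. gam (V K) = l * gam K"
    "\<And>K. (\<lambda>(a, b, c, d, e, g). case K of (A, B, C, \<alpha>, \<beta>, \<gamma>) \<Rightarrow>
      g * (A + B - 2 * C) + \<gamma> * (a + b - 2 * c) - 2 * (\<alpha> - \<beta>) * (d - e)) (V K) = m * Zplus K"
    "\<And>K. (\<lambda>(a, b, c, d, e, g). case K of (A, B, C, \<alpha>, \<beta>, \<gamma>) \<Rightarrow>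
      g * (A + B + 2 * C) + \<gamma> * (a + b + 2 * c) - 2 * (\<alpha> + \<beta>) * (d + e)) (V K) = n * Zminus K"
  proof -
    from assms(1) consider "V = V1" | "V = V2" | "V = V3" | "V = V4" | "V = V5" | "V = V6" by auto
    then show thesis
    \<comment> \<open>the triples are the eigenvalues of the field on gam, Zplus and Zminus\<close>
    proof cases
      case 1 show ?thesis by (rule that[of 0 0 0]) (auto simp: 1 algebra_simps power2_eq_square)
    next
      case 2 show ?thesis by (rule that[of 0 0 0]) (auto simp: 2 algebra_simps power2_eq_square)
    next
      case 3 show ?thesis by (rule that[of 0 "- 2" 2]) (auto simp: 3 algebra_simps power2_eq_square)
    next
      case 4 show ?thesis by (rule that[of 0 2 2]) (auto simp: 4 algebra_simps power2_eq_square)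
    next
      case 5 show ?thesis by (rule that[of 0 0 0]) (auto simp: 5 algebra_simps power2_eq_square)
    next
      case 6 show ?thesis by (rule that[of 1 2 2]) (auto simp: 6 algebra_simps power2_eq_square)
    qed
  qed
  from sc(1)[OF this(1)] sc(2)[OF this(2)] sc(3)[OF this(3)]
  show "\<exists>a>0. gam (\<phi> t K) = a * gam K" "\<exists>b>0. Zplus (\<phi> t K) = b * Zplus K"
    "\<exists>c>0. Zminus (\<phi> t K) = c * Zminus K"
    by (metis exp_gt_zero)+
qed

text \<open>
  Where one of \<open>Zplus\<close>, \<open>Zminus\<close> vanishes, the sign of the sum is the sign of the other one,
  whichever it is; this is symmetric under the swap of the two by \<open>R1\<close> and \<open>R2\<close>.
\<close>

definition region_of_sign :: "real \<Rightarrow> killing set" where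
  "region_of_sign e = {K. gam K \<noteq> 0 \<and> Zplus K * Zminus K = 0 \<and> sgn (Zplus K + Zminus K) = e}"

lemma region_of_sign_GM_generators:
  assumes "g \<in> GM_generators"
  shows "g K \<in> region_of_sign e \<longleftrightarrow> K \<in> region_of_sign e"
proof -
  from assms consider V \<phi> t where "V \<in> {V1, V2, V3, V4, V5, V6}" "is_flow V \<phi>" "g = \<phi> t"
    | "g = R0" | "g = R1" | "g = R2"
    by (auto simp: GM_generators_def)
  then show ?thesis
  proof cases
    case 1
    obtain a b c where "a > 0" "b > 0" "c > 0" "gam (g K) = a * gam K"
      "Zplus (g K) = b * Zplus K" "Zminus (g K) = c * Zminus K"
      using flow_invariants[OF 1(1,2)] 1(3) by metis
    then show ?thesis
      by (cases "Zplus K = 0"; cases "Zminus K = 0")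
        (auto simp: region_of_sign_def sgn_mult)
  qed (auto simp: region_of_sign_def Z_R0 Z_R1 Z_R2 add.commute)
qed

text \<open>
  The equivalence, rather than one implication, passes from a generator to its inverse.
\<close>

lemma region_of_sign_GM:
  assumes "g \<in> carrier GM"
  shows "g K \<in> region_of_sign e \<longleftrightarrow> K \<in> region_of_sign e"
proof -
  have "g \<in> generate (BijGroup UNIV) GM_generators" using assms by (simp add: GM_def)
  then show ?thesis
  proof (induction arbitrary: K rule: generate.induct)
    case one
    then show ?case by (simp add: BijGroup_def)
  next
    case (incl h)
    then show ?case by (rule region_of_sign_GM_generators)
  next
    case (inv h)
    have h: "h \<in> Bij UNIV" using inv GM_generators_subset by (auto simp: BijGroup_def)
    then have "inv\<^bsub>BijGroup UNIV\<^esub> h = inv_into UNIV h"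
      by (simp add: inv_BijGroup restrict_def)
    moreover have "h (inv_into UNIV h K) = K"
      using h by (simp add: Bij_def bij_betw_def surj_f_inv_f)
    ultimately show ?case using region_of_sign_GM_generators[OF inv] by metis
  next
    case (eng h1 h2)
    have "generate (BijGroup UNIV) GM_generators \<subseteq> Bij (UNIV :: killing set)"
      using subgroup.subset[OF group.generate_is_subgroup[OF group_BijGroup GM_generators_subset]]
      by (simp add: BijGroup_def)
    with eng show ?case by (auto simp: BijGroup_def compose_def)
  qed
qed

section \<open>Normal forms and orbits\<close>

lemma flow_V1: "is_flow V1 (\<lambda>s (A, B, C, \<alpha>, \<beta>, \<gamma>).
    (A, B - 2 * \<beta> * s + \<gamma> * s\<^sup>2, C - \<alpha> * s, \<alpha>, \<beta> - \<gamma> * s, \<gamma>))"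
  unfolding is_flow_def
  by (auto intro!: has_vector_derivative_Pair derivative_eq_intros
      simp: algebra_simps power2_eq_square zero_prod_def
      simp flip: has_real_derivative_iff_has_vector_derivative)

lemma flow_V2: "is_flow V2 (\<lambda>s (A, B, C, \<alpha>, \<beta>, \<gamma>).
    (A - 2 * \<alpha> * s + \<gamma> * s\<^sup>2, B, C - \<beta> * s, \<alpha> - \<gamma> * s, \<beta>, \<gamma>))"
  unfolding is_flow_def
  by (auto intro!: has_vector_derivative_Pair derivative_eq_intros
      simp: algebra_simps power2_eq_square zero_prod_def
      simp flip: has_real_derivative_iff_has_vector_derivative)

lemma flow_V4: "is_flow V4 (\<lambda>s (A, B, C, \<alpha>, \<beta>, \<gamma>).
    (exp (2 * s) * A, exp (2 * s) * B, exp (2 * s) * C, exp s * \<alpha>, exp s * \<beta>, \<gamma>))"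
  unfolding is_flow_def
  by (auto intro!: has_vector_derivative_Pair derivative_eq_intros
      simp: algebra_simps exp_add zero_prod_def
      simp flip: has_real_derivative_iff_has_vector_derivative)

lemma flow_V5: "is_flow V5 (\<lambda>s (A, B, C, \<alpha>, \<beta>, \<gamma>). (A + s, B - s, C, \<alpha>, \<beta>, \<gamma>))"
  unfolding is_flow_def
  by (auto intro!: has_vector_derivative_Pair derivative_eq_intros
      simp: algebra_simps zero_prod_def
      simp flip: has_real_derivative_iff_has_vector_derivative)

lemma flow_V6: "is_flow V6 (\<lambda>s (A, B, C, \<alpha>, \<beta>, \<gamma>).
    (exp s * A, exp s * B, exp s * C, exp s * \<alpha>, exp s * \<beta>, exp s * \<gamma>))"
  unfolding is_flow_def
  by (auto intro!: has_vector_derivative_Pair derivative_eq_intros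
      simp: algebra_simps exp_add zero_prod_def
      simp flip: has_real_derivative_iff_has_vector_derivative)

interpretation GM: group_action GM UNIV "\<lambda>g. g"
  by (rule GM_group_action)

abbreviation GM_orbit :: "killing \<Rightarrow> killing set" where
  "GM_orbit \<equiv> orbit GM (\<lambda>g. g)"

lemma GM_orbit_trans: "L \<in> GM_orbit K \<Longrightarrow> M \<in> GM_orbit L \<Longrightarrow> M \<in> GM_orbit K"
  using GM.orbit_trans by blast

lemma generator_orbit: "g \<in> GM_generators \<Longrightarrow> g K \<in> GM_orbit K"
  by (auto simp: orbit_def GM_def intro: generate.incl)

lemma flow_orbit:
  assumes "V \<in> {V1, V2, V3, V4, V5, V6}" "is_flow V \<phi>" "\<phi> t K = L"
  shows "L \<in> GM_orbit K"
  using assms generator_orbit[of "\<phi> t" K] unfolding GM_generators_def by blast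

lemma R_orbit: "R0 K \<in> GM_orbit K" "R1 K \<in> GM_orbit K"
  by (auto intro!: generator_orbit simp: GM_generators_def)

text \<open>
  A tensor with \<open>\<alpha> = \<beta> = 0\<close> and \<open>A = B\<close> has \<open>Zplus = 2 \<gamma> (A - C)\<close> and \<open>Zminus = 2 \<gamma> (A + C)\<close>,
  so if \<open>Zplus = 0\<close> it is \<open>(a, a, a, 0, 0, \<gamma>)\<close> with \<open>a\<close> of the sign of \<open>Zminus\<close>.  The flow of \<open>V6\<close> scales all entries and
  normalises \<open>\<gamma>\<close>, that of \<open>V4\<close> fixes \<open>\<gamma>\<close> and normalises \<open>\<bar>a\<bar>\<close>.
\<close>

lemma normal_form_positive:
  assumes "gam K > 0" "Zplus K = 0" "sgn (Zminus K) = e" "e \<noteq> 0"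
  shows "(e, e, e, 0, 0, 1) \<in> GM_orbit K"
proof (cases K)
  case (fields A B C \<alpha> \<beta> \<gamma>)
  have \<gamma>: "\<gamma> > 0" using assms(1) fields by simp
  \<comment> \<open>the value of the entry C once the translations have removed both linear terms\<close>
  define a where "a = C - \<alpha> * \<beta> / \<gamma>"
  have half: "(A - \<alpha>\<^sup>2 / \<gamma>) + (B - \<beta>\<^sup>2 / \<gamma>) - 2 * a = Zplus K / \<gamma>"
    using \<gamma> unfolding fields a_def by (simp add: field_simps power2_eq_square)
  have "Zminus K - Zplus K = 4 * (\<gamma> * C - \<alpha> * \<beta>)"
    unfolding fields by (simp add: algebra_simps power2_eq_square)
  also have "\<gamma> * C - \<alpha> * \<beta> = \<gamma> * a"
    using \<gamma> unfolding a_def by (simp add: right_diff_distrib)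
  finally have "sgn a = e" using assms(2,3) \<gamma> by (simp add: sgn_mult)
  then have a: "a \<noteq> 0" and e: "e = a / \<bar>a\<bar>" using assms(4) by (auto simp: sgn_if)
  have square: "\<gamma> * (x / \<gamma>)\<^sup>2 = x\<^sup>2 / \<gamma>" "x * (x / \<gamma>) = x\<^sup>2 / \<gamma>" for x
    using \<gamma> by (simp_all add: power2_eq_square)
  have 1: "(A, B - \<beta>\<^sup>2 / \<gamma>, a, \<alpha>, 0, \<gamma>) \<in> GM_orbit K"
    by (rule flow_orbit[OF _ flow_V1, where t = "\<beta> / \<gamma>"])
       (use \<gamma> square[of \<beta>] in \<open>simp_all add: fields a_def\<close>)
  have 2: "(A - \<alpha>\<^sup>2 / \<gamma>, B - \<beta>\<^sup>2 / \<gamma>, a, 0, 0, \<gamma>) \<in> GM_orbit (A, B - \<beta>\<^sup>2 / \<gamma>, a, \<alpha>, 0, \<gamma>)"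
    by (rule flow_orbit[OF _ flow_V2, where t = "\<alpha> / \<gamma>"])
       (use \<gamma> square[of \<alpha>] in simp_all)
  have 3: "(a, a, a, 0, 0, \<gamma>) \<in> GM_orbit (A - \<alpha>\<^sup>2 / \<gamma>, B - \<beta>\<^sup>2 / \<gamma>, a, 0, 0, \<gamma>)"
    by (rule flow_orbit[OF _ flow_V5, where t = "a - (A - \<alpha>\<^sup>2 / \<gamma>)"])
       (use half assms(2) in simp_all)
  have 4: "(a / \<gamma>, a / \<gamma>, a / \<gamma>, 0, 0, 1) \<in> GM_orbit (a, a, a, 0, 0, \<gamma>)"
    by (rule flow_orbit[OF _ flow_V6, where t = "- ln \<gamma>"])
       (use \<gamma> in \<open>simp_all add: exp_minus inverse_eq_divide\<close>)
  have "exp (2 * (- ln q / 2)) = 1 / q" if "q > 0" for q :: real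
  proof -
    have "2 * (- ln q / 2) = - ln q" by simp
    with that show ?thesis by (simp only: exp_minus exp_ln inverse_eq_divide)
  qed
  from this[of "\<bar>a\<bar> / \<gamma>"] have "exp (2 * (- ln (\<bar>a\<bar> / \<gamma>) / 2)) = \<gamma> / \<bar>a\<bar>"
    using \<gamma> a by simp
  then have 5: "(e, e, e, 0, 0, 1) \<in> GM_orbit (a / \<gamma>, a / \<gamma>, a / \<gamma>, 0, 0, 1)"
    by (intro flow_orbit[OF _ flow_V4, where t = "- ln (\<bar>a\<bar> / \<gamma>) / 2"])
       (use \<gamma> in \<open>simp_all add: e\<close>)
  from 1 2 3 4 5 show ?thesis by (blast intro: GM_orbit_trans)
qed

lemma normal_form:
  assumes "K \<in> region_of_sign e" "e \<noteq> 0"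
  shows "(e, e, e, 0, 0, 1) \<in> GM_orbit K"
proof -
  obtain L where L: "L \<in> GM_orbit K" "gam L > 0" "L \<in> region_of_sign e"
  proof (cases "gam K > 0")
    case True
    then show ?thesis using that assms GM.orbit_refl by blast
  next
    case False
    with assms show ?thesis using that[of "R0 K"] R_orbit
      by (auto simp: region_of_sign_def Z_R0)
  qed
  obtain M where M: "M \<in> GM_orbit L" "gam M > 0" "Zplus M = 0" "sgn (Zminus M) = e"
  proof (cases "Zplus L = 0")
    case True
    then show ?thesis using that[of L] L GM.orbit_refl by (auto simp: region_of_sign_def)
  next
    case False
    then show ?thesis using that[of "R1 L"] L R_orbit
      by (auto simp: region_of_sign_def Z_R1)
  qed
  show ?thesis
    using L(1) M(1) normal_form_positive[OF M(2-4) assms(2)] by (blast intro: GM_orbit_trans)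
qed

text \<open>
  Invariance bounds the orbit from above; the common normal form shows that nothing is missing.
\<close>

lemma orbit_eq_region_of_sign:
  assumes "K \<in> region_of_sign e" "e \<noteq> 0"
  shows "GM_orbit K = region_of_sign e"
proof
  show "GM_orbit K \<subseteq> region_of_sign e"
    using assms(1) region_of_sign_GM unfolding orbit_def by blast
  show "region_of_sign e \<subseteq> GM_orbit K"
  proof
    fix L assume "L \<in> region_of_sign e"
    then have "L \<in> GM_orbit (e, e, e, 0, 0, 1)"
      using normal_form assms(2) GM.orbit_sym by blast
    then show "L \<in> GM_orbit K" using normal_form[OF assms] GM_orbit_trans by blast
  qed
qed

lemma region_of_sign_nonempty: "e = 1 \<or> e = - 1 \<Longrightarrow> (e, e, e, 0, 0, 1) \<in> region_of_sign e"
  by (auto simp: region_of_sign_def)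

lemma orbits_region:
  "orbits GM (S2 - (S1 \<union> S3)) (\<lambda>g. g) = {region_of_sign 1, region_of_sign (- 1)}"
proof -
  have "S2 - (S1 \<union> S3) = region_of_sign 1 \<union> region_of_sign (- 1)"
    unfolding region_eq region_of_sign_def by (auto simp: sgn_if split: if_splits)
  moreover have "orbits GM E (\<lambda>g. g) = GM_orbit ` E" for E
    by (simp only: orbits_def Setcompr_eq_image)
  ultimately show ?thesis
    using orbit_eq_region_of_sign[of _ 1] orbit_eq_region_of_sign[of _ "- 1"]
      region_of_sign_nonempty[of 1] region_of_sign_nonempty[of "- 1"]
    by (auto simp: image_Un image_constant_conv cong: image_cong)
qed

lemma region_of_sign_eq:
  assumes "e = 1 \<or> e = - 1"
  shows "region_of_sign e =
    sign_class 1 0 e \<union> sign_class 1 e 0 \<union> sign_class (- 1) 0 e \<union> sign_class (- 1) e 0"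
  using assms unfolding sign_class_def region_eq region_of_sign_def
  by (auto simp: sgn_if split: if_splits)

theorem proposition21:
  shows "(\<forall>T \<in> {\<Theta>1, \<Theta>2, \<Theta>3, \<Theta>4, \<Theta>5, \<Theta>6, \<Theta>7, \<Theta>8}. connected T)
    \<and> components (S2 - (S1 \<union> S3)) = {\<Theta>1, \<Theta>2, \<Theta>3, \<Theta>4, \<Theta>5, \<Theta>6, \<Theta>7, \<Theta>8}
    \<and> card (components (S2 - (S1 \<union> S3))) = 8
    \<and> S2 - (S1 \<union> S3) = (\<Theta>1 \<union> \<Theta>3 \<union> \<Theta>5 \<union> \<Theta>7) \<union> (\<Theta>2 \<union> \<Theta>4 \<union> \<Theta>6 \<union> \<Theta>8)
    \<and> orbits GM (S2 - (S1 \<union> S3)) (\<lambda>g. g)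
        = {\<Theta>1 \<union> \<Theta>3 \<union> \<Theta>5 \<union> \<Theta>7, \<Theta>2 \<union> \<Theta>4 \<union> \<Theta>6 \<union> \<Theta>8}
    \<and> card (orbits GM (S2 - (S1 \<union> S3)) (\<lambda>g. g)) = 2
    \<and> (\<forall>X \<in> {\<Theta>1, \<Theta>3, \<Theta>5, \<Theta>7}. \<forall>Y \<in> {\<Theta>1, \<Theta>3, \<Theta>5, \<Theta>7}. linked_by {R0, R1} X Y)
    \<and> (\<forall>X \<in> {\<Theta>2, \<Theta>4, \<Theta>6, \<Theta>8}. \<forall>Y \<in> {\<Theta>2, \<Theta>4, \<Theta>6, \<Theta>8}. linked_by {R0, R1} X Y)"
proof (intro conjI)
  have pos: "region_of_sign 1 = \<Theta>1 \<union> \<Theta>3 \<union> \<Theta>5 \<union> \<Theta>7"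
    unfolding \<Theta>1_def \<Theta>3_def \<Theta>5_def \<Theta>7_def by (rule region_of_sign_eq) simp
  have neg: "region_of_sign (- 1) = \<Theta>2 \<union> \<Theta>4 \<union> \<Theta>6 \<union> \<Theta>8"
    unfolding \<Theta>2_def \<Theta>4_def \<Theta>6_def \<Theta>8_def by (rule region_of_sign_eq) simp
  show "\<forall>T \<in> {\<Theta>1, \<Theta>2, \<Theta>3, \<Theta>4, \<Theta>5, \<Theta>6, \<Theta>7, \<Theta>8}. connected T"
    unfolding Theta_family using connected_sign_class by auto
  show "components (S2 - (S1 \<union> S3)) = {\<Theta>1, \<Theta>2, \<Theta>3, \<Theta>4, \<Theta>5, \<Theta>6, \<Theta>7, \<Theta>8}"
    unfolding Theta_family by (rule components_region)
  show "card (components (S2 - (S1 \<union> S3))) = 8"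
    by (simp add: components_region card_image[OF inj_on_sign_class] card_sign_patterns)
  show "S2 - (S1 \<union> S3) = (\<Theta>1 \<union> \<Theta>3 \<union> \<Theta>5 \<union> \<Theta>7) \<union> (\<Theta>2 \<union> \<Theta>4 \<union> \<Theta>6 \<union> \<Theta>8)"
    unfolding pos[symmetric] neg[symmetric] region_eq region_of_sign_def
    by (auto simp: sgn_if split: if_splits)
  show "orbits GM (S2 - (S1 \<union> S3)) (\<lambda>g. g)
        = {\<Theta>1 \<union> \<Theta>3 \<union> \<Theta>5 \<union> \<Theta>7, \<Theta>2 \<union> \<Theta>4 \<union> \<Theta>6 \<union> \<Theta>8}"
    unfolding orbits_region pos neg ..
  have "region_of_sign 1 \<noteq> region_of_sign (- 1)"
  proof
    assume "region_of_sign 1 = region_of_sign (- 1)"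
    then have "(1, 1, 1, 0, 0, 1) \<in> region_of_sign (- 1)"
      using region_of_sign_nonempty[of 1] by simp
    then show False by (simp add: region_of_sign_def)
  qed
  then show "card (orbits GM (S2 - (S1 \<union> S3)) (\<lambda>g. g)) = 2"
    by (simp add: orbits_region)
  show "\<forall>X \<in> {\<Theta>1, \<Theta>3, \<Theta>5, \<Theta>7}. \<forall>Y \<in> {\<Theta>1, \<Theta>3, \<Theta>5, \<Theta>7}. linked_by {R0, R1} X Y"
    unfolding \<Theta>1_def \<Theta>3_def \<Theta>5_def \<Theta>7_def by (auto intro!: linked_sign_classes)
  show "\<forall>X \<in> {\<Theta>2, \<Theta>4, \<Theta>6, \<Theta>8}. \<forall>Y \<in> {\<Theta>2, \<Theta>4, \<Theta>6, \<Theta>8}. linked_by {R0, R1} X Y"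
    unfolding \<Theta>2_def \<Theta>4_def \<Theta>6_def \<Theta>8_def by (auto intro!: linked_sign_classes)
qed

end
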